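(* Let $$T=\{(1,1),(2,0),(0,2),(3,2),(2,3),(6,3),(3,6),(9,6),(6,9),(10,5),(5,10),(14,5),(5,14)\}.$$ Then every element of $\mathcal{V}(\{(0,1),(1,0)\})$ (the $\mathcal{V}$-set in $\mathbb{Z}^2$ generated by $(0,1)$ and $(1,0)$) outside of $T$ and other than the generators $(0,1),(1,0)$ must use an element of $T$ in its (unique) representation as a sum of two previous elements; that is, at least one of the two summands in that representation belongs to $T$.
   Context: The $\mathcal{V}$-set $\mathcal{V}(\{(0,1),(1,0)\})\subset\mathbb{Z}_{\ge 0}^2$ is built as follows, with the size of $(x,y)$ being $x+y$: first put in the generators $(0,1)$ and $(1,0)$; then repeatedly add a smallest element not already in the set that is uniquely represented as the sum of two (not necessarily distinct) elements already in the set (with $p+q$ and $q+p$ the same representation). Ties may be broken arbitrarily without affecting the resulting set. Equivalently, an element other than the generators is in the set iff it equals $p+q$ for exactly one unordered pair of not necessarily distinct elements $p,q$ of the set. *)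

theory Defs
  imports Complex_Main "HOL-Library.Product_Plus"
begin

definition size2 :: "nat \<times> nat \<Rightarrow> nat" where
  "size2 v = fst v + snd v"

text \<open>
  The representations of \<open>v\<close> as a sum of two not necessarily distinct elements of \<open>A\<close>.
  A representation is encoded by the set \<open>{p, q}\<close> of its summands, so that \<open>p + q\<close> and \<open>q + p\<close>
  are the same representation and \<open>p + p\<close> is the singleton \<open>{p}\<close>.
\<close>
definition reps :: "(nat \<times> nat) set \<Rightarrow> nat \<times> nat \<Rightarrow> (nat \<times> nat) set set" where
  "reps A v = {{p, q} | p q. p \<in> A \<and> q \<in> A \<and> p + q = v}"

definition candidates :: "(nat \<times> nat) set \<Rightarrow> (nat \<times> nat) set" where
  "candidates A = {v. v \<notin> A \<and> (\<exists>!P. P \<in> reps A v)}"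

definition vstep :: "(nat \<times> nat) set \<Rightarrow> (nat \<times> nat) set \<Rightarrow> bool" where
  "vstep A B \<longleftrightarrow>
     (if candidates A = {} then B = A
      else \<exists>v. is_arg_min size2 (\<lambda>w. w \<in> candidates A) v \<and> B = insert v A)"

text \<open>
  \<open>V\<close> is the union of the stages of some run of the construction from the generators \<open>G\<close>.
  This is a relation because ties between candidates of the same size may be broken in any way.
\<close>
definition is_vset :: "(nat \<times> nat) set \<Rightarrow> (nat \<times> nat) set \<Rightarrow> bool" where
  "is_vset G V \<longleftrightarrow>
     (\<exists>A. A 0 = G \<and> (\<forall>n. vstep (A n) (A (Suc n))) \<and> V = (\<Union>n. A n))"

lemma vstep_exists: "\<exists>B. vstep A B"
proof (cases "candidates A = {}")
  case False
  then obtain w where "w \<in> candidates A" by blast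
  then have "is_arg_min size2 (\<lambda>w. w \<in> candidates A) (arg_min size2 (\<lambda>w. w \<in> candidates A))"
    by (metis arg_min_natI arg_min_nat_le is_arg_min_linorder)
  with False show ?thesis unfolding vstep_def by metis
qed (simp add: vstep_def)

lemma is_vset_exists: "\<exists>V. is_vset G V"
proof -
  have "\<exists>A. A 0 = G \<and> (\<forall>n. vstep (A n) (A (Suc n)))"
    using dependent_nat_choice[of "\<lambda>n A. n = 0 \<longrightarrow> A = G" "\<lambda>n. vstep"] vstep_exists by auto
  then show ?thesis unfolding is_vset_def by blast
qed

definition T :: "(nat \<times> nat) set" where
  "T = {(1,1), (2,0), (0,2), (3,2), (2,3), (6,3), (3,6), (9,6), (6,9),
        (10,5), (5,10), (14,5), (5,14)}"

end

theory Submission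
  imports Defs
begin

text \<open>
  Call a pair \<open>(x, y)\<close> a \<^emph>\<open>core\<close> point if its residues modulo 4 are one of
  \<open>(1,0)\<close>, \<open>(3,0)\<close>, \<open>(0,1)\<close>, \<open>(0,3)\<close>, \<open>(2,2)\<close>. A sum of two core
  points is never a core point (lemma \<open>core_add_core\<close>). The whole \<open>V\<close>-set
  consists of core points, except for points of \<open>T\<close> (lemma \<open>subset_core_T\<close>). Hence
  an element outside \<open>T\<close> is a core point, its two summands cannot both be core points, and so one of
  them lies in \<open>T\<close>. The generators are core points as well, so this covers summands that are generators.

  What has to be shown is therefore that a point outside both \<open>core\<close> and \<open>T\<close>
  has no representation or at least two. The \<open>V\<close>-set is irregular in the
  interior of the quadrant, but its first four columns are eventually periodic, and so are the first four
  rows by symmetry. These already supply two representations for almost all points in question. For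
  example, if \<open>x\<close> and \<open>y\<close> are odd and have remainders \<open>r\<close> and
  \<open>s\<close> modulo 4, then \<open>(x, y)\<close> equals both \<open>(x, 0) + (0, y)\<close> and
  \<open>(r, y - s) + (x - r, s)\<close>, and all four summands belong to the set as soon as \<open>x\<close> and
  \<open>y\<close> are not too small. A few columns escape this argument; there eight further elements serve as
  summands. They come from an explicit computation of the set in a box, which also settles the points of
  the box themselves.

  Since summands are smaller than their sum, membership is determined by recursion, and the recursion
  restricts to every region closed under summands (lemma \<open>vset_on_unique\<close>). This gives the first
  columns (lemma \<open>vset_on_strip\<close>) and the box (lemma \<open>vset_on_box\<close>) by
  verifying an explicit guess, and it gives the symmetry in the two coordinates.
\<close>

section \<open>Unique representation as a local recursion\<close>

text \<open>
  The set \<open>D\<close> restricts the recursion to a region; all proofs below work with regions that are closed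
  under taking summands. The condition \<open>0 \<notin> S\<close> makes the recursion well-founded: otherwise
  the origin could represent itself as \<open>0 + 0\<close>.
\<close>
definition vset_on :: "(nat \<times> nat) set \<Rightarrow> (nat \<times> nat) set \<Rightarrow> (nat \<times> nat) set \<Rightarrow> bool" where
  "vset_on D G S \<longleftrightarrow> 0 \<notin> S \<and> (\<forall>v\<in>D. v \<in> S \<longleftrightarrow> v \<in> G \<or> (\<exists>!P. P \<in> reps S v))"

lemma repsI: "p \<in> A \<Longrightarrow> q \<in> A \<Longrightarrow> p + q = v \<Longrightarrow> {p, q} \<in> reps A v"
  unfolding reps_def by blast

lemma repsE:
  assumes "P \<in> reps A v"
  obtains p q where "P = {p, q}" "p \<in> A" "q \<in> A" "p + q = v"
  using assms unfolding reps_def by blast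

text \<open>
  A representation is determined by either of its summands, so uniqueness can be tested on single
  points instead of two-element sets, starting from any known representation.
\<close>
lemma ex1_reps_iff_forall:
  assumes pq: "p \<in> A" "q \<in> A" "p + q = v"
  shows "(\<exists>!P. P \<in> reps A v) \<longleftrightarrow> (\<forall>p'\<in>A. \<forall>q'\<in>A. p' + q' = v \<longrightarrow> p' = p \<or> p' = q)"
    (is "?L \<longleftrightarrow> ?R")
proof
  assume ?L
  show ?R
  proof (intro ballI impI)
    fix p' q' assume "p' \<in> A" "q' \<in> A" "p' + q' = v"
    then have "{p', q'} = {p, q}" using \<open>?L\<close> repsI[OF pq] repsI[of p' A q' v] by blast
    then show "p' = p \<or> p' = q" by blast
  qed
next
  assume ?R
  show ?L
  proof
    show "{p, q} \<in> reps A v" by (rule repsI[OF pq])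
    fix P assume "P \<in> reps A v"
    then obtain p' q' where P: "P = {p', q'}" "p' \<in> A" "q' \<in> A" "p' + q' = v" by (rule repsE)
    then consider "p' = p" | "p' = q" using \<open>?R\<close> by blast
    then show "P = {p, q}"
    proof cases
      case 1
      with P(4) pq(3) have "p + q' = p + q" by simp
      then show ?thesis using P(1) 1 by simp
    next
      case 2
      with P(4) pq(3) have "q + q' = q + p" by (simp add: add.commute)
      then show ?thesis using P(1) 2 by (simp add: insert_commute)
    qed
  qed
qed

lemma ex1_reps_iff:
  "(\<exists>!P. P \<in> reps A v) \<longleftrightarrow>
   (\<exists>p\<in>A. \<exists>q\<in>A. p + q = v \<and> (\<forall>p'\<in>A. \<forall>q'\<in>A. p' + q' = v \<longrightarrow> p' = p \<or> p' = q))"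
proof
  assume u: "\<exists>!P. P \<in> reps A v"
  then obtain P where "P \<in> reps A v" by blast
  then obtain p q where "p \<in> A" "q \<in> A" "p + q = v" by (rule repsE)
  with u ex1_reps_iff_forall[of p A q v] show
    "\<exists>p\<in>A. \<exists>q\<in>A. p + q = v \<and> (\<forall>p'\<in>A. \<forall>q'\<in>A. p' + q' = v \<longrightarrow> p' = p \<or> p' = q)" by blast
next
  assume "\<exists>p\<in>A. \<exists>q\<in>A. p + q = v \<and> (\<forall>p'\<in>A. \<forall>q'\<in>A. p' + q' = v \<longrightarrow> p' = p \<or> p' = q)"
  then obtain p q where "p \<in> A" "q \<in> A" "p + q = v"
    "\<forall>p'\<in>A. \<forall>q'\<in>A. p' + q' = v \<longrightarrow> p' = p \<or> p' = q" by blast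
  then show "\<exists>!P. P \<in> reps A v" by (simp only: ex1_reps_iff_forall simp_thms)
qed

lemma size2_summand_less:
  assumes "p + q = v" "p \<noteq> 0" "q \<noteq> 0"
  shows "size2 p < size2 v" "size2 q < size2 v"
  using assms by (cases p; cases q; auto simp: size2_def zero_prod_def)+

lemma reps_mono: "A \<subseteq> B \<Longrightarrow> reps A v \<subseteq> reps B v"
  unfolding reps_def by blast

lemma reps_cong_below:
  assumes "0 \<notin> A" "0 \<notin> B" "\<And>p q. p + q = v \<Longrightarrow> size2 p < size2 v \<Longrightarrow> p \<in> A \<longleftrightarrow> p \<in> B"
  shows "reps A v = reps B v"
proof -
  have *: "p \<in> A \<and> q \<in> A \<longleftrightarrow> p \<in> B \<and> q \<in> B" if "p + q = v" for p q
  proof (cases "p = 0 \<or> q = 0")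
    case True
    then show ?thesis using assms(1,2) by auto
  next
    case False
    then have "size2 p < size2 v" "size2 q < size2 v" using size2_summand_less[OF that] by auto
    moreover have "q + p = v" using that by (simp add: add.commute)
    ultimately show ?thesis using assms(3) that by blast
  qed
  show ?thesis unfolding reps_def using * by blast
qed

text \<open>
  Both summands of a point are smaller than the point, so membership is decided by recursion on the size
  inside any region closed under summands. This reduces a statement about \<open>V\<close> on such a
  region to checking that an explicitly given set satisfies the same recursion there.
\<close>
lemma vset_on_unique:
  assumes "vset_on D G S" "vset_on D G S'"
    and down: "\<And>p q. p + q \<in> D \<Longrightarrow> p \<in> D"
    and "v \<in> D"
  shows "v \<in> S \<longleftrightarrow> v \<in> S'"
  using \<open>v \<in> D\<close>
proof (induction v rule: measure_induct_rule[of size2])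
  case (less v)
  have "reps S v = reps S' v"
  proof (rule reps_cong_below)
    show "p \<in> S \<longleftrightarrow> p \<in> S'" if "p + q = v" "size2 p < size2 v" for p q
      using less that down by blast
  qed (use assms in \<open>auto simp: vset_on_def\<close>)
  with assms(1,2) less.prems show ?case by (simp add: vset_on_def)
qed

text \<open>
  The outcome of the greedy construction, whatever the order in which ties are resolved, satisfies the
  order-free recursion. This needs two facts about a run: once \<open>v\<close> has entered, nothing smaller
  than \<open>v\<close> enters any more, so its representation stays unique; and no point can remain a
  candidate for ever.
\<close>
lemma is_vset_imp_vset_on:
  assumes "is_vset G V" "0 \<notin> G"
  shows "vset_on UNIV G V"
proof -
  obtain A where A0: "A 0 = G" and step: "\<And>n. vstep (A n) (A (Suc n))" and V: "V = (\<Union>n. A n)"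
    using assms(1) unfolding is_vset_def by blast
  have step_cases: "candidates (A n) = {} \<and> A (Suc n) = A n \<or>
      (\<exists>v. v \<in> candidates (A n) \<and> (\<forall>w\<in>candidates (A n). size2 v \<le> size2 w) \<and> A (Suc n) = insert v (A n))"
    for n
    using step[of n] unfolding vstep_def is_arg_min_linorder by (metis (no_types, lifting))
  have mono: "A m \<subseteq> A n" if "m \<le> n" for m n
    using that by (rule lift_Suc_mono_le[rotated]) (use step_cases in blast)
  have zero: "0 \<notin> A n" for n
  proof (induction n)
    case (Suc n)
    have "0 \<notin> candidates (A n)" using Suc by (auto simp: candidates_def reps_def zero_prod_def)
    with Suc step_cases[of n] show ?case by auto
  qed (simp add: A0 assms(2))
  \<comment> \<open>Sizes never decrease along a run. Take the first element smaller than \<open>v\<close> that enters after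
    the stage that adds \<open>v\<close>: nothing below it has changed in between, so it was already a candidate
    at that stage, and the minimality of \<open>v\<close> forbids this.\<close>
  have later: "size2 v \<le> size2 w"
    if v: "v \<in> candidates (A n)" "\<forall>w\<in>candidates (A n). size2 v \<le> size2 w" "A (Suc n) = insert v (A n)"
      and w: "w \<in> A m" "w \<notin> A n" for v w n m
    using w
  proof (induction m arbitrary: w)
    case 0
    then show ?case using mono[of 0 n] by auto
  next
    case (Suc m)
    show ?case
    proof (cases "w \<in> A m")
      case True
      then show ?thesis using Suc by blast
    next
      case False
      then have cand: "w \<in> candidates (A m)" using Suc.prems step_cases[of m] by auto
      have "n \<le> m" using Suc.prems mono[of "Suc m" n] by (metis not_less_eq_eq subsetD)
      show ?thesis
      proof (rule ccontr)
        assume "\<not> ?thesis"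
        then have less: "size2 w < size2 v" by simp
        have "reps (A n) w = reps (A m) w"
        proof (rule reps_cong_below)
          show "p \<in> A n \<longleftrightarrow> p \<in> A m" if "size2 p < size2 w" for p
            using Suc.IH[of p] less that mono[OF \<open>n \<le> m\<close>] by force
        qed (simp_all add: zero)
        then have "w \<in> candidates (A n)"
          using cand Suc.prems by (simp add: candidates_def)
        with v(2) less show False by force
      qed
    qed
  qed
  have in_iff: "v \<in> V \<longleftrightarrow> (\<exists>!P. P \<in> reps V v)" if vG: "v \<notin> G" for v
  proof
    assume "v \<in> V"
    then obtain m where "v \<in> A m" using V by blast
    define n where "n = (LEAST n. v \<in> A n)"
    have n: "v \<in> A n" "\<And>k. k < n \<Longrightarrow> v \<notin> A k"
      unfolding n_def using \<open>v \<in> A m\<close> by (auto intro: LeastI dest: not_less_Least)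
    then obtain k where k: "n = Suc k" using A0 vG by (cases n) auto
    then have "v \<notin> A k" using n by simp
    with n k step_cases[of k] have c: "v \<in> candidates (A k)"
      "\<forall>w\<in>candidates (A k). size2 v \<le> size2 w" "A (Suc k) = insert v (A k)" by auto
    have "reps (A k) v = reps V v"
    proof (rule reps_cong_below)
      show "p \<in> A k \<longleftrightarrow> p \<in> V" if "size2 p < size2 v" for p
        using later[OF c, of p] that unfolding V by force
    qed (use zero V in auto)
    with c(1) show "\<exists>!P. P \<in> reps V v" by (simp add: candidates_def)
  next
    assume u: "\<exists>!P. P \<in> reps V v"
    show "v \<in> V"
    proof (rule ccontr)
      assume nV: "v \<notin> V"
      obtain P where P: "P \<in> reps V v" and Pu: "\<And>Q. Q \<in> reps V v \<Longrightarrow> Q = P" using u by blast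
      then obtain p q i j where pq: "P = {p, q}" "p \<in> A i" "q \<in> A j" "p + q = v"
        unfolding reps_def V by blast
      define m where "m = max i j"
      \<comment> \<open>From stage \<open>m\<close> on, \<open>v\<close> is a candidate, so every step adds a point of size at most that of
        \<open>v\<close>. There are only finitely many such points.\<close>
      have cand: "v \<in> candidates (A n)" if "m \<le> n" for n
      proof -
        have "p \<in> A n" "q \<in> A n"
          using pq mono[of i n] mono[of j n] that unfolding m_def by auto
        then have "P \<in> reps (A n) v"
          using pq unfolding reps_def by blast
        moreover have "Q = P" if "Q \<in> reps (A n) v" for Q
          using Pu that reps_mono[of "A n" V v] V by blast
        ultimately show ?thesis using nV V unfolding candidates_def by blast
      qed
      define F where "F = {w :: nat \<times> nat. size2 w \<le> size2 v}"
      have "F \<subseteq> {..size2 v} \<times> {..size2 v}" by (auto simp: F_def size2_def)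
      then have finF: "finite F" by (rule finite_subset) simp
      have grow: "k \<le> card (A (m + k) \<inter> F)" for k
      proof (induction k)
        case (Suc k)
        obtain w where w: "w \<in> candidates (A (m + k))" "size2 w \<le> size2 v"
          "A (Suc (m + k)) = insert w (A (m + k))"
          using step_cases[of "m + k"] cand[of "m + k"] by fastforce
        have "A (m + Suc k) \<inter> F = insert w (A (m + k) \<inter> F)" using w by (auto simp: F_def)
        moreover have "w \<notin> A (m + k) \<inter> F" using w by (auto simp: candidates_def)
        ultimately show ?case using Suc finF by simp
      qed simp
      have "Suc (card F) \<le> card (A (m + Suc (card F)) \<inter> F)" by (rule grow)
      also have "\<dots> \<le> card F" using finF by (intro card_mono) auto
      finally show False by simp
    qed
  qed
  have "G \<subseteq> V" using A0 V by blast
  moreover have "0 \<notin> V" using zero V by simp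
  ultimately show ?thesis unfolding vset_on_def using in_iff by (metis subsetD)
qed

lemma vset_on_subset: "vset_on D G S \<Longrightarrow> D' \<subseteq> D \<Longrightarrow> vset_on D' G S"
  by (auto simp: vset_on_def)

lemma ex1_reps_swap:
  assumes "\<exists>!P. P \<in> reps A v"
  shows "\<exists>!P. P \<in> reps {w. prod.swap w \<in> A} (prod.swap v)"
proof -
  obtain p q where pq: "p \<in> A" "q \<in> A" "p + q = v"
    and u: "\<And>p' q'. p' \<in> A \<Longrightarrow> q' \<in> A \<Longrightarrow> p' + q' = v \<Longrightarrow> p' = p \<or> p' = q"
    using assms unfolding ex1_reps_iff by blast
  have "p' = prod.swap p \<or> p' = prod.swap q"
    if "prod.swap p' \<in> A" "prod.swap q' \<in> A" "p' + q' = prod.swap v" for p' q'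
  proof -
    have "prod.swap p' + prod.swap q' = v" using that(3)
      by (metis add_Pair prod.collapse swap_simp swap_swap)
    then show ?thesis using u that by (metis swap_swap)
  qed
  moreover have "prod.swap p + prod.swap q = prod.swap v"
    using pq(3) by (cases p; cases q) auto
  moreover have "prod.swap p \<in> {w. prod.swap w \<in> A}" "prod.swap q \<in> {w. prod.swap w \<in> A}"
    using pq(1,2) by simp_all
  ultimately show ?thesis unfolding ex1_reps_iff by blast
qed

lemma vset_on_swap:
  assumes "vset_on UNIV G S"
  shows "vset_on UNIV {w. prod.swap w \<in> G} {w. prod.swap w \<in> S}"
proof -
  have *: "prod.swap v \<in> S \<longleftrightarrow> prod.swap v \<in> G \<or> (\<exists>!P. P \<in> reps S (prod.swap v))" for v
    using assms unfolding vset_on_def by (elim conjE ballE) auto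
  have "(\<exists>!P. P \<in> reps S (prod.swap v)) \<longleftrightarrow> (\<exists>!P. P \<in> reps {w. prod.swap w \<in> S} v)" for v
  proof
    show "\<exists>!P. P \<in> reps {w. prod.swap w \<in> S} v" if "\<exists>!P. P \<in> reps S (prod.swap v)"
      using ex1_reps_swap[OF that] unfolding swap_swap .
    show "\<exists>!P. P \<in> reps S (prod.swap v)" if "\<exists>!P. P \<in> reps {w. prod.swap w \<in> S} v"
      using ex1_reps_swap[OF that] unfolding mem_Collect_eq swap_swap Collect_mem_eq .
  qed
  note * = *[unfolded this]
  have "0 \<notin> S" using assms unfolding vset_on_def by blast
  then have "prod.swap 0 \<notin> S" by (simp add: zero_prod_def)
  then show ?thesis unfolding vset_on_def mem_Collect_eq using * by (intro conjI ballI)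
qed

section \<open>The first four columns\<close>

lemma ex1_repsI:
  assumes "(a, b) \<in> A" "(c, d) \<in> A" "a + c = x" "b + d = y"
    and "\<And>a' b' c' d'. (a', b') \<in> A \<Longrightarrow> (c', d') \<in> A \<Longrightarrow> a' + c' = x \<Longrightarrow> b' + d' = y \<Longrightarrow>
      a' = a \<and> b' = b \<or> a' = c \<and> b' = d"
  shows "\<exists>!P. P \<in> reps A (x, y)"
proof -
  have sum: "(a, b) + (c, d) = (x, y)" using assms(3,4) by simp
  show ?thesis
    unfolding ex1_reps_iff_forall[OF assms(1,2) sum] Ball_def split_paired_All add_Pair prod.inject
    using assms(5) by blast
qed

lemma not_ex1_repsI:
  assumes "(a, b) \<in> A" "(a', b') \<in> A" "(c, d) \<in> A" "(c', d') \<in> A"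
    and "a + a' = x" "b + b' = y" "c + c' = x" "d + d' = y"
    and "c \<noteq> a \<or> d \<noteq> b" "c \<noteq> a' \<or> d \<noteq> b'"
  shows "\<not> (\<exists>!P. P \<in> reps A (x, y))"
proof -
  have "{(a, b), (a', b')} \<in> reps A (x, y)"
    using assms(5,6) by (intro repsI[OF assms(1,2)]) simp
  moreover have "{(c, d), (c', d')} \<in> reps A (x, y)"
    using assms(7,8) by (intro repsI[OF assms(3,4)]) simp
  moreover have "{(a, b), (a', b')} \<noteq> {(c, d), (c', d')}"
    using assms(9,10) by (metis insertI1 insert_iff prod.inject singletonD)
  moreover have "P \<in> R \<Longrightarrow> Q \<in> R \<Longrightarrow> P \<noteq> Q \<Longrightarrow> \<not> (\<exists>!P. P \<in> R)"
    for P Q :: "(nat \<times> nat) set" and R by blast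
  ultimately show ?thesis by metis
qed

text \<open>
  The columns \<open>x = 0, 1, 2, 3\<close> of the \<open>V\<close>-set. All four are periodic with
  period 4 apart from a few points near the axis.
\<close>
definition strip :: "(nat \<times> nat) set" where
  "strip = {(x, y).
     x = 0 \<and> (y = 2 \<or> odd y) \<or>
     x = 1 \<and> (y = 1 \<or> y mod 4 = 0) \<or>
     x = 2 \<and> (y = 0 \<or> y = 3 \<or> y mod 4 = 2 \<and> 6 \<le> y) \<or>
     x = 3 \<and> (y = 0 \<or> y = 2 \<or> y = 6 \<or> y mod 4 = 0 \<and> 12 \<le> y)}"

lemma strip_iff:
  "(0, y) \<in> strip \<longleftrightarrow> y = 2 \<or> odd y"
  "(1, y) \<in> strip \<longleftrightarrow> y = 1 \<or> y mod 4 = 0"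
  "(2, y) \<in> strip \<longleftrightarrow> y = 0 \<or> y = 3 \<or> y mod 4 = 2 \<and> 6 \<le> y"
  "(3, y) \<in> strip \<longleftrightarrow> y = 0 \<or> y = 2 \<or> y = 6 \<or> y mod 4 = 0 \<and> 12 \<le> y"
  by (simp_all add: strip_def)

lemma sum_eq_0: "a + c = 0 \<Longrightarrow> a = 0 \<and> c = 0"
  and sum_eq_1: "a + c = 1 \<Longrightarrow> a = 0 \<and> c = 1 \<or> a = 1 \<and> c = 0"
  and sum_eq_2: "a + c = 2 \<Longrightarrow> a = 0 \<and> c = 2 \<or> a = 1 \<and> c = 1 \<or> a = 2 \<and> c = 0"
  and sum_eq_3: "a + c = 3 \<Longrightarrow> a = 0 \<and> c = 3 \<or> a = 1 \<and> c = 2 \<or> a = 2 \<and> c = 1 \<or> a = 3 \<and> c = 0"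
  for a c :: nat
  by linarith+

text \<open>
  The witness in each case is the pair of summands; the rest of the case is the linear arithmetic fact
  that no other pair of points of the strip has the same sum.
\<close>
lemma strip_unique:
  assumes "(x, y) \<in> strip" "(x, y) \<notin> {(0, 1), (1, 0)}" "x \<le> 3"
  shows "\<exists>!P. P \<in> reps strip (x, y)"
proof -
  consider "x = 0" | "x = 1" | "x = 2" | "x = 3" using \<open>x \<le> 3\<close> by linarith
  then show ?thesis
  proof cases
    case 1
    have "(0, y) \<in> strip" "y \<noteq> 1" using assms(1,2) 1 by simp_all
    then consider "y = 2" | "odd y" "3 \<le> y"
      unfolding strip_iff by atomize_elim presburger
    then have "\<exists>!P. P \<in> reps strip (0, y)"
    proof cases
      case 1 then show ?thesis
        by - (intro ex1_repsI[of 0 1 _ 0 1], ((unfold strip_iff)?; presburger)+,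
            (drule sum_eq_0; elim disjE conjE; hypsubst; unfold strip_iff; elim disjE conjE; presburger))
    next
      case 2 then show ?thesis
        by - (intro ex1_repsI[of 0 2 _ 0 "y - 2"], ((unfold strip_iff)?; presburger)+,
            (drule sum_eq_0; elim disjE conjE; hypsubst; unfold strip_iff; elim disjE conjE; presburger))
    qed
    then show ?thesis using 1 by simp
  next
    case 2
    have "(1, y) \<in> strip" "y \<noteq> 0" using assms(1,2) 2 by simp_all
    then consider "y = 1" | "y mod 4 = 0" "4 \<le> y"
      unfolding strip_iff by atomize_elim presburger
    then have "\<exists>!P. P \<in> reps strip (1, y)"
    proof cases
      case 1 then show ?thesis
        by - (intro ex1_repsI[of 1 0 _ 0 1], ((unfold strip_iff)?; presburger)+,
            (drule sum_eq_1; elim disjE conjE; hypsubst; unfold strip_iff; elim disjE conjE; presburger))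
    next
      case 2 then show ?thesis
        by - (intro ex1_repsI[of 1 1 _ 0 "y - 1"], ((unfold strip_iff)?; presburger)+,
            (drule sum_eq_1; elim disjE conjE; hypsubst; unfold strip_iff; elim disjE conjE; presburger))
    qed
    then show ?thesis using 2 by simp
  next
    case 3
    have "(2, y) \<in> strip" using assms(1,2) 3 by simp_all
    then consider "y = 0" | "y = 3" | "y mod 4 = 2" "6 \<le> y"
      unfolding strip_iff by atomize_elim presburger
    then have "\<exists>!P. P \<in> reps strip (2, y)"
    proof cases
      case 1 then show ?thesis
        by - (intro ex1_repsI[of 1 0 _ 1 0], ((unfold strip_iff)?; presburger)+,
            (drule sum_eq_2; elim disjE conjE; hypsubst; unfold strip_iff; elim disjE conjE; presburger))
    next
      case 2 then show ?thesis
        by - (intro ex1_repsI[of 2 0 _ 0 3], ((unfold strip_iff)?; presburger)+,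
            (drule sum_eq_2; elim disjE conjE; hypsubst; unfold strip_iff; elim disjE conjE; presburger))
    next
      case 3 then show ?thesis
        by - (intro ex1_repsI[of 2 3 _ 0 "y - 3"], ((unfold strip_iff)?; presburger)+,
            (drule sum_eq_2; elim disjE conjE; hypsubst; unfold strip_iff; elim disjE conjE; presburger))
    qed
    then show ?thesis using 3 by simp
  next
    case 4
    have "(3, y) \<in> strip" using assms(1,2) 4 by simp_all
    then consider "y = 0" | "y = 2" | "y = 6" | "y mod 4 = 0" "12 \<le> y"
      unfolding strip_iff by atomize_elim presburger
    then have "\<exists>!P. P \<in> reps strip (3, y)"
    proof cases
      case 1 then show ?thesis
        by - (intro ex1_repsI[of 2 0 _ 1 0], ((unfold strip_iff)?; presburger)+,
            (drule sum_eq_3; elim disjE conjE; hypsubst; unfold strip_iff; elim disjE conjE; presburger))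
    next
      case 2 then show ?thesis
        by - (intro ex1_repsI[of 3 0 _ 0 2], ((unfold strip_iff)?; presburger)+,
            (drule sum_eq_3; elim disjE conjE; hypsubst; unfold strip_iff; elim disjE conjE; presburger))
    next
      case 3 then show ?thesis
        by - (intro ex1_repsI[of 2 6 _ 1 0], ((unfold strip_iff)?; presburger)+,
            (drule sum_eq_3; elim disjE conjE; hypsubst; unfold strip_iff; elim disjE conjE; presburger))
    next
      case 4 then show ?thesis
        by - (intro ex1_repsI[of 2 0 _ 1 y], ((unfold strip_iff)?; presburger)+,
            (drule sum_eq_3; elim disjE conjE; hypsubst; unfold strip_iff; elim disjE conjE; presburger))
    qed
    then show ?thesis using 4 by simp
  qed
qed

text \<open>
  Apart from the origin, which has no representation at all, each missing point has two different
  representations inside the strip.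
\<close>
lemma strip_not_unique:
  assumes "(x, y) \<notin> strip" "x \<le> 3"
  shows "\<not> (\<exists>!P. P \<in> reps strip (x, y))"
proof -
  consider "x = 0" | "x = 1" | "x = 2" | "x = 3" using \<open>x \<le> 3\<close> by linarith
  then show ?thesis
  proof cases
    case 1
    have "(0, y) \<notin> strip" using assms(1) 1 by simp
    then consider "y = 0" | "y = 4" | "even y" "6 \<le> y"
      unfolding strip_iff by atomize_elim presburger
    then have "\<not> (\<exists>!P. P \<in> reps strip (0, y))"
    proof cases
      case 1 then show ?thesis by (auto simp: reps_def strip_def)
    next
      case 2 then show ?thesis
        by (intro not_ex1_repsI[of 0 1 _ 0 3 0 2 0 2]; (unfold strip_iff)?; presburger)
    next
      case 3 then show ?thesis
        by (intro not_ex1_repsI[of 0 1 _ 0 "y - 1" 0 3 0 "y - 3"]; (unfold strip_iff)?; presburger)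
    qed
    then show ?thesis using 1 by simp
  next
    case 2
    have "(1, y) \<notin> strip" using assms(1) 2 by simp
    then consider "y = 2" | "y = 3" | "odd y" "5 \<le> y" | "y mod 4 = 2" "6 \<le> y"
      unfolding strip_iff by atomize_elim presburger
    then have "\<not> (\<exists>!P. P \<in> reps strip (1, y))"
    proof cases
      case 1 then show ?thesis
        by (intro not_ex1_repsI[of 1 0 _ 0 2 1 1 0 1]; (unfold strip_iff)?; presburger)
    next
      case 2 then show ?thesis
        by (intro not_ex1_repsI[of 1 0 _ 0 3 1 1 0 2]; (unfold strip_iff)?; presburger)
    next
      case 3 then show ?thesis
        by (intro not_ex1_repsI[of 1 0 _ 0 y 1 4 0 "y - 4"]; (unfold strip_iff)?; presburger)
    next
      case 4 then show ?thesis
        by (intro not_ex1_repsI[of 1 1 _ 0 "y - 1" 1 "y - 2" 0 2]; (unfold strip_iff)?; presburger)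
    qed
    then show ?thesis using 2 by simp
  next
    case 3
    have "(2, y) \<notin> strip" using assms(1) 3 by simp
    then consider "y = 1" | "y = 2" | "y mod 4 = 0" "4 \<le> y" | "y mod 4 = 1" "5 \<le> y" | "y mod 4 = 3" "7 \<le> y"
      unfolding strip_iff by atomize_elim presburger
    then have "\<not> (\<exists>!P. P \<in> reps strip (2, y))"
    proof cases
      case 1 then show ?thesis
        by (intro not_ex1_repsI[of 2 0 _ 0 1 1 0 1 1]; (unfold strip_iff)?; presburger)
    next
      case 2 then show ?thesis
        by (intro not_ex1_repsI[of 2 0 _ 0 2 1 1 1 1]; (unfold strip_iff)?; presburger)
    next
      case 3 then show ?thesis
        by (intro not_ex1_repsI[of 2 3 _ 0 "y - 3" 1 0 1 y]; (unfold strip_iff)?; presburger)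
    next
      case 4 then show ?thesis
        by (intro not_ex1_repsI[of 2 0 _ 0 y 1 1 1 "y - 1"]; (unfold strip_iff)?; presburger)
    next
      case 5 then show ?thesis
        by (intro not_ex1_repsI[of 2 0 _ 0 y 2 6 0 "y - 6"]; (unfold strip_iff)?; presburger)
    qed
    then show ?thesis using 3 by simp
  next
    case 4
    have "(3, y) \<notin> strip" using assms(1) 4 by simp
    then consider "y = 1" | "odd y" "3 \<le> y" | "y = 4" | "y = 8" | "y mod 4 = 2" "10 \<le> y"
      unfolding strip_iff by atomize_elim presburger
    then have "\<not> (\<exists>!P. P \<in> reps strip (3, y))"
    proof cases
      case 1 then show ?thesis
        by (intro not_ex1_repsI[of 3 0 _ 0 1 2 0 1 1]; (unfold strip_iff)?; presburger)
    next
      case 2 then show ?thesis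
        by (intro not_ex1_repsI[of 3 0 _ 0 y 3 2 0 "y - 2"]; (unfold strip_iff)?; presburger)
    next
      case 3 then show ?thesis
        by (intro not_ex1_repsI[of 3 2 _ 0 2 2 0 1 4]; (unfold strip_iff)?; presburger)
    next
      case 4 then show ?thesis
        by (intro not_ex1_repsI[of 3 6 _ 0 2 2 0 1 8]; (unfold strip_iff)?; presburger)
    next
      case 5 then show ?thesis
        by (intro not_ex1_repsI[of 2 y _ 1 0 2 6 1 "y - 6"]; (unfold strip_iff)?; presburger)
    qed
    then show ?thesis using 4 by simp
  qed
qed

lemma vset_on_strip: "vset_on {v. fst v \<le> 3} {(0, 1), (1, 0)} strip"
proof -
  have "(x, y) \<in> strip \<longleftrightarrow> (x, y) \<in> {(0, 1), (1, 0)} \<or> (\<exists>!P. P \<in> reps strip (x, y))" if "x \<le> 3" for x y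
  proof -
    have "{(0, 1), (1, 0)} \<subseteq> strip" by (auto simp: strip_def)
    then show ?thesis using strip_unique[of x y] strip_not_unique[of x y] that by blast
  qed
  moreover have "0 \<notin> strip" by (simp add: strip_def zero_prod_def)
  ultimately show ?thesis unfolding vset_on_def by auto
qed

section \<open>A finite box\<close>

text \<open>
  The entry with index \<open>x\<close> lists the heights at which the \<open>V\<close>-set meets column \<open>x\<close>
  below height 25. The size is chosen to reach the point \<open>(9, 24)\<close> in the corner, which serves as
  a summand of \<open>(11, 27)\<close>.
\<close>
definition box_column :: "nat list list" where
  "box_column =
    [[1, 2, 3, 5, 7, 9, 11, 13, 15, 17, 19, 21, 23],
     [0, 1, 4, 8, 12, 16, 20, 24],
     [0, 3, 6, 10, 14, 18, 22],
     [0, 2, 6, 12, 16, 20, 24],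
     [1, 7],
     [0, 10, 14],
     [2, 3, 9],
     [0, 4, 16],
     [1, 13, 19, 23],
     [0, 6, 16, 20, 24]]"

definition box :: "(nat \<times> nat) set" where
  "box = {(x, y). x < 10 \<and> y \<in> set (box_column ! x)}"

definition box_summands :: "nat \<Rightarrow> nat \<Rightarrow> (nat \<times> nat) list" where
  "box_summands x y =
    [(a, b). a \<leftarrow> [0..<Suc x], b \<leftarrow> box_column ! a, b \<le> y \<and> y - b \<in> set (box_column ! (x - a))]"

text \<open>
  An executable test: the first summand found and its complement must be the only summands.
\<close>
definition box_unique :: "nat \<Rightarrow> nat \<Rightarrow> bool" where
  "box_unique x y \<longleftrightarrow> (case box_summands x y of [] \<Rightarrow> False
     | (a, b) # ps \<Rightarrow> list_all (\<lambda>(c, d). c = a \<and> d = b \<or> c = x - a \<and> d = y - b) ps)"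

lemma box_check:
  "list_all (\<lambda>x. list_all (\<lambda>y.
     (y \<in> set (box_column ! x)) = ((x, y) = (0, 1) \<or> (x, y) = (1, 0) \<or> box_unique x y))
     [0..<25]) [0..<10]"
  by code_simp

lemma in_set_box_summands:
  assumes "x < 10"
  shows "(a, b) \<in> set (box_summands x y) \<longleftrightarrow>
    a \<le> x \<and> b \<le> y \<and> (a, b) \<in> box \<and> (x - a, y - b) \<in> box"
  using assms by (auto simp: box_summands_def box_def)

lemma add_Pair_eq_iff:
  fixes a b x y :: nat
  shows "(a, b) + q = (x, y) \<longleftrightarrow> a \<le> x \<and> b \<le> y \<and> q = (x - a, y - b)"
  by (cases q) auto

lemma box_unique_iff:
  assumes x: "x < 10"
  shows "box_unique x y \<longleftrightarrow> (\<exists>!P. P \<in> reps box (x, y))"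
proof (cases "box_summands x y")
  case Nil
  have "reps box (x, y) = {}"
  proof (rule ccontr)
    assume "reps box (x, y) \<noteq> {}"
    then obtain p q where pq: "p \<in> box" "q \<in> box" "p + q = (x, y)" unfolding reps_def by blast
    obtain a b where p: "p = (a, b)" by fastforce
    have "(a, b) \<in> set (box_summands x y)"
      using pq unfolding in_set_box_summands[OF x] p add_Pair_eq_iff by blast
    then show False using Nil by simp
  qed
  then have "\<not> (\<exists>!P. P \<in> reps box (x, y))" by blast
  then show ?thesis by (simp add: box_unique_def Nil)
next
  case (Cons p ps)
  obtain a b where p: "p = (a, b)" by fastforce
  have summands: "set (box_summands x y) = {p \<in> box. \<exists>q\<in>box. p + q = (x, y)}"
  proof (rule set_eqI)
    fix p :: "nat \<times> nat"
    obtain c d where "p = (c, d)" by fastforce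
    then show "p \<in> set (box_summands x y) \<longleftrightarrow> p \<in> {p \<in> box. \<exists>q\<in>box. p + q = (x, y)}"
      unfolding mem_Collect_eq by (simp only: in_set_box_summands[OF x] add_Pair_eq_iff) blast
  qed
  have ab: "(a, b) \<in> box" "(x - a, y - b) \<in> box" "(a, b) + (x - a, y - b) = (x, y)"
    using in_set_box_summands[OF x, of a b y] unfolding Cons p by auto
  have "(\<exists>!P. P \<in> reps box (x, y)) \<longleftrightarrow>
    (\<forall>p\<in>set (box_summands x y). p = (a, b) \<or> p = (x - a, y - b))"
    unfolding ex1_reps_iff_forall[OF ab] summands by blast
  also have "\<dots> \<longleftrightarrow> box_unique x y"
    unfolding box_unique_def Cons p list_all_iff by auto
  finally show ?thesis ..
qed

lemma vset_on_box: "vset_on ({..<10} \<times> {..<25}) {(0, 1), (1, 0)} box"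
proof -
  have "(x, y) \<in> box \<longleftrightarrow> (x, y) \<in> {(0, 1), (1, 0)} \<or> (\<exists>!P. P \<in> reps box (x, y))"
    if "x < 10" "y < 25" for x y
  proof -
    have "y \<in> set (box_column ! x) \<longleftrightarrow> (x, y) = (0, 1) \<or> (x, y) = (1, 0) \<or> box_unique x y"
      by (rule box_check[unfolded list_all_iff, THEN bspec, THEN bspec]) (use that in simp_all)
    then show ?thesis using that unfolding box_unique_iff[OF that(1)] box_def by simp
  qed
  moreover have "0 \<notin> box" by (simp add: box_def box_column_def zero_prod_def)
  ultimately show ?thesis unfolding vset_on_def by auto
qed

section \<open>Residues modulo 4\<close>

definition core :: "(nat \<times> nat) set" where
  "core = {(x, y). (x mod 4, y mod 4) \<in> {(1, 0), (3, 0), (0, 1), (0, 3), (2, 2)}}"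

text \<open>
  The reason behind the theorem: the five residue pairs form a sum-free subset of the group of residue
  pairs modulo 4.
\<close>
lemma core_add_core:
  assumes "p \<in> core" "q \<in> core"
  shows "p + q \<notin> core"
proof -
  obtain a b c d where pq: "p = (a, b)" "q = (c, d)" by fastforce
  have "((a + c) mod 4, (b + d) mod 4) = ((a mod 4 + c mod 4) mod 4, (b mod 4 + d mod 4) mod 4)"
    by (simp only: mod_add_eq)
  moreover have "((r + t) mod 4, (s + u) mod 4) \<notin> R"
    if "(r, s) \<in> R" "(t, u) \<in> R" "R = {(1, 0), (3, 0), (0, 1), (0, 3), (2, 2)}"
    for r s t u :: nat and R
    using that(1,2) unfolding that(3) by (elim insertE emptyE Pair_inject) simp_all
  ultimately show ?thesis
    using assms unfolding pq core_def mem_Collect_eq add_Pair prod.case by metis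
qed

lemma swap_in_core_T:
  assumes "(x, y) \<in> core \<union> T"
  shows "(y, x) \<in> core \<union> T"
  using assms
proof
  assume "(x, y) \<in> core"
  then have "(y, x) \<in> core"
    unfolding core_def mem_Collect_eq prod.case by (elim insertE emptyE Pair_inject) simp_all
  then show ?thesis ..
next
  assume "(x, y) \<in> T"
  then have "(y, x) \<in> T" unfolding T_def by (elim insertE emptyE) simp_all
  then show ?thesis ..
qed

lemma strip_subset: "strip \<subseteq> core \<union> T"
proof -
  have column_0: "(0, y) \<in> core \<union> T" if "y = 2 \<or> odd y" for y
  proof -
    have "y = 2 \<or> y mod 4 = 1 \<or> y mod 4 = 3" using that by presburger
    then show ?thesis by (elim disjE) (simp_all add: core_def T_def)
  qed
  have column_1: "(1, y) \<in> core \<union> T" if "y = 1 \<or> y mod 4 = 0" for y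
    using that by (elim disjE) (simp_all add: core_def T_def)
  have column_2: "(2, y) \<in> core \<union> T" if "y = 0 \<or> y = 3 \<or> y mod 4 = 2 \<and> 6 \<le> y" for y
    using that by (elim disjE conjE) (simp_all add: core_def T_def)
  have column_3: "(3, y) \<in> core \<union> T" if "y = 0 \<or> y = 2 \<or> y = 6 \<or> y mod 4 = 0 \<and> 12 \<le> y" for y
    using that by (elim disjE conjE) (simp_all add: core_def T_def)
  show ?thesis
  proof
    fix p assume "p \<in> strip"
    then obtain x y where p: "p = (x, y)" and mem: "(x, y) \<in> strip" by (cases p) simp
    from mem have "x \<le> 3"
      unfolding strip_def mem_Collect_eq prod.case by (elim disjE conjE) simp_all
    then consider "x = 0" | "x = 1" | "x = 2" | "x = 3" by linarith
    then show "p \<in> core \<union> T"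
    proof cases
      case 1
      from mem show ?thesis unfolding p 1 strip_iff by (rule column_0)
    next
      case 2
      from mem show ?thesis unfolding p 2 strip_iff by (rule column_1)
    next
      case 3
      from mem show ?thesis unfolding p 3 strip_iff by (rule column_2)
    next
      case 4
      from mem show ?thesis unfolding p 4 strip_iff by (rule column_3)
    qed
  qed
qed

lemma box_subset: "box \<subseteq> core \<union> T"
proof -
  have check: "list_all (\<lambda>x. list_all (\<lambda>y. (x, y) \<in> core \<union> T) (box_column ! x)) [0..<10]"
    by (simp add: upt_rec box_column_def core_def T_def)
  have "(x, y) \<in> core \<union> T" if "(x, y) \<in> box" for x y
  proof -
    have mem: "x \<in> set [0..<10]" "y \<in> set (box_column ! x)" using that by (simp_all add: box_def)
    from check[unfolded list_all_iff, THEN bspec, OF mem(1), THEN bspec, OF mem(2)]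
    show ?thesis .
  qed
  then show ?thesis by auto
qed

context
  fixes V :: "(nat \<times> nat) set"
  assumes V: "vset_on UNIV {(0, 1), (1, 0)} V"
begin

lemma swap_in_iff: "(y, x) \<in> V \<longleftrightarrow> (x, y) \<in> V"
proof -
  have "{w :: nat \<times> nat. prod.swap w \<in> {(0, 1), (1, 0)}} = {(0, 1), (1, 0)}" by auto
  with vset_on_swap[OF V] have "vset_on UNIV {(0, 1), (1, 0)} {w. prod.swap w \<in> V}" by simp
  from vset_on_unique[OF V this UNIV_I UNIV_I, of "(y, x)"] show ?thesis by simp
qed

lemma in_iff_strip: "x \<le> 3 \<Longrightarrow> (x, y) \<in> V \<longleftrightarrow> (x, y) \<in> strip"
  by (rule vset_on_unique[OF vset_on_subset[OF V subset_UNIV] vset_on_strip]) auto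

lemma in_iff_box: "x < 10 \<Longrightarrow> y < 25 \<Longrightarrow> (x, y) \<in> V \<longleftrightarrow> (x, y) \<in> box"
  by (rule vset_on_unique[OF vset_on_subset[OF V subset_UNIV] vset_on_box]) auto

lemma near_columns:
  "(0, y) \<in> V \<longleftrightarrow> y = 2 \<or> odd y"
  "(1, y) \<in> V \<longleftrightarrow> y = 1 \<or> y mod 4 = 0"
  "(2, y) \<in> V \<longleftrightarrow> y = 0 \<or> y = 3 \<or> y mod 4 = 2 \<and> 6 \<le> y"
  "(3, y) \<in> V \<longleftrightarrow> y = 0 \<or> y = 2 \<or> y = 6 \<or> y mod 4 = 0 \<and> 12 \<le> y"
  by (simp_all add: in_iff_strip strip_def)

lemma near_rows:
  "(x, 0) \<in> V \<longleftrightarrow> x = 2 \<or> odd x"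
  "(x, 1) \<in> V \<longleftrightarrow> x = 1 \<or> x mod 4 = 0"
  "(x, 2) \<in> V \<longleftrightarrow> x = 0 \<or> x = 3 \<or> x mod 4 = 2 \<and> 6 \<le> x"
  "(x, 3) \<in> V \<longleftrightarrow> x = 0 \<or> x = 2 \<or> x = 6 \<or> x mod 4 = 0 \<and> 12 \<le> x"
  by (simp_all only: swap_in_iff[of x] near_columns)

text \<open>
  The only points with both coordinates above 3 that serve as summands below.
\<close>
lemma far_members:
  "(4, 7) \<in> V" "(7, 4) \<in> V" "(8, 13) \<in> V" "(8, 19) \<in> V" "(8, 23) \<in> V"
  "(9, 16) \<in> V" "(9, 20) \<in> V" "(9, 24) \<in> V"
  by (simp_all add: in_iff_box box_def box_column_def)

lemma not_in_if_two_reps: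
  assumes "(a, b) \<in> V" "(a', b') \<in> V" "(c, d) \<in> V" "(c', d') \<in> V"
    and "a + a' = x" "b + b' = y" "c + c' = x" "d + d' = y"
    and "c \<noteq> a \<or> d \<noteq> b" "c \<noteq> a' \<or> d \<noteq> b'" "2 \<le> x"
  shows "(x, y) \<notin> V"
  using not_ex1_repsI[OF assms(1-10)] V \<open>2 \<le> x\<close> unfolding vset_on_def by auto

text \<open>
  The next four lemmas go through the residue pairs outside \<open>core\<close>. A point with large
  coordinates is split into an element of one of the first four columns and an element of one of the
  first four rows, in two ways. The families with a fixed first coordinate are the columns in which one of
  these summands is missing, because row 2 is periodic only from \<open>x = 6\<close> on and row 3
  only from \<open>x = 12\<close> on.
\<close>
lemma absent_even_even:
  "(4 + 2 * a, 12 + 4 * b) \<notin> V"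
  "(12 + 4 * a, 10 + 4 * b) \<notin> V"
  "(4, 10 + 4 * b) \<notin> V"
  "(8, 26 + 4 * b) \<notin> V"
  subgoal by (rule not_in_if_two_reps[of 1 "12 + 4 * b" "3 + 2 * a" 0 3 "12 + 4 * b" "1 + 2 * a" 0]; simp add: near_columns near_rows far_members del: One_nat_def)
  subgoal by (rule not_in_if_two_reps[of "12 + 4 * a" 1 0 "9 + 4 * b" "12 + 4 * a" 3 0 "7 + 4 * b"]; simp add: near_columns near_rows far_members del: One_nat_def)
  subgoal by (rule not_in_if_two_reps[of 4 1 0 "9 + 4 * b" 4 7 0 "3 + 4 * b"]; simp add: near_columns near_rows far_members del: One_nat_def)
  subgoal by (rule not_in_if_two_reps[of 8 1 0 "25 + 4 * b" 8 13 0 "13 + 4 * b"]; simp add: near_columns near_rows far_members del: One_nat_def)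
  done

lemma absent_2_mod_4_odd:
  "(14 + 4 * a, 13 + 4 * b) \<notin> V"
  "(6, 13 + 4 * b) \<notin> V"
  "(10, 25 + 4 * b) \<notin> V"
  "(10, 13) \<notin> V"
  "(10, 17) \<notin> V"
  "(10, 21) \<notin> V"
  "(6 + 4 * a, 11 + 4 * b) \<notin> V"
  subgoal by (rule not_in_if_two_reps[of "14 + 4 * a" 2 0 "11 + 4 * b" 2 "10 + 4 * b" "12 + 4 * a" 3]; simp add: near_columns near_rows far_members del: One_nat_def)
  subgoal by (rule not_in_if_two_reps[of 6 2 0 "11 + 4 * b" 4 7 2 "6 + 4 * b"]; simp add: near_columns near_rows far_members del: One_nat_def)
  subgoal by (rule not_in_if_two_reps[of 10 2 0 "23 + 4 * b" 8 19 2 "6 + 4 * b"]; simp add: near_columns near_rows far_members del: One_nat_def)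
  subgoal by (rule not_in_if_two_reps[of 10 2 0 11 8 13 2 0]; simp add: near_columns near_rows far_members del: One_nat_def)
  subgoal by (rule not_in_if_two_reps[of 10 2 0 15 9 16 1 1]; simp add: near_columns near_rows far_members del: One_nat_def)
  subgoal by (rule not_in_if_two_reps[of 10 2 0 19 9 20 1 1]; simp add: near_columns near_rows far_members del: One_nat_def)
  subgoal by (rule not_in_if_two_reps[of "6 + 4 * a" 2 0 "9 + 4 * b" 2 "10 + 4 * b" "4 + 4 * a" 1]; simp add: near_columns near_rows far_members del: One_nat_def)
  done

lemma absent_odd_2_mod_4:
  "(9 + 4 * a, 14 + 4 * b) \<notin> V"
  "(5, 26 + 4 * b) \<notin> V"
  "(7 + 4 * a, 10 + 4 * b) \<notin> V"
  subgoal by (rule not_in_if_two_reps[of 2 "14 + 4 * b" "7 + 4 * a" 0 "6 + 4 * a" 2 3 "12 + 4 * b"]; simp add: near_columns near_rows far_members del: One_nat_def)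
  subgoal by (rule not_in_if_two_reps[of 2 "26 + 4 * b" 3 0 3 "20 + 4 * b" 2 6]; simp add: near_columns near_rows far_members del: One_nat_def)
  subgoal by (rule not_in_if_two_reps[of 2 "10 + 4 * b" "5 + 4 * a" 0 "6 + 4 * a" 2 1 "8 + 4 * b"]; simp add: near_columns near_rows far_members del: One_nat_def)
  done

lemma absent_odd_odd:
  "(5 + 4 * a, 13 + 4 * b) \<notin> V"
  "(13 + 4 * a, 11 + 4 * b) \<notin> V"
  "(5, 15 + 4 * b) \<notin> V"
  "(9, 15 + 4 * b) \<notin> V"
  "(7 + 4 * a, 13 + 4 * b) \<notin> V"
  "(15 + 4 * a, 15 + 4 * b) \<notin> V"
  "(7, 11 + 4 * b) \<notin> V"
  "(11, 31 + 4 * b) \<notin> V"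
  "(11, 11) \<notin> V"
  "(11, 15) \<notin> V"
  "(11, 19) \<notin> V"
  "(11, 23) \<notin> V"
  "(11, 27) \<notin> V"
  subgoal by (rule not_in_if_two_reps[of "5 + 4 * a" 0 0 "13 + 4 * b" 1 "12 + 4 * b" "4 + 4 * a" 1]; simp add: near_columns near_rows far_members del: One_nat_def)
  subgoal by (rule not_in_if_two_reps[of "13 + 4 * a" 0 0 "11 + 4 * b" 1 "8 + 4 * b" "12 + 4 * a" 3]; simp add: near_columns near_rows far_members del: One_nat_def)
  subgoal by (rule not_in_if_two_reps[of 5 0 0 "15 + 4 * b" 2 3 3 "12 + 4 * b"]; simp add: near_columns near_rows far_members del: One_nat_def)
  subgoal by (rule not_in_if_two_reps[of 9 0 0 "15 + 4 * b" 6 3 3 "12 + 4 * b"]; simp add: near_columns near_rows far_members del: One_nat_def)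
  subgoal by (rule not_in_if_two_reps[of "7 + 4 * a" 0 0 "13 + 4 * b" 3 "12 + 4 * b" "4 + 4 * a" 1]; simp add: near_columns near_rows far_members del: One_nat_def)
  subgoal by (rule not_in_if_two_reps[of "15 + 4 * a" 0 0 "15 + 4 * b" 3 "12 + 4 * b" "12 + 4 * a" 3]; simp add: near_columns near_rows far_members del: One_nat_def)
  subgoal by (rule not_in_if_two_reps[of 7 0 0 "11 + 4 * b" 6 3 1 "8 + 4 * b"]; simp add: near_columns near_rows far_members del: One_nat_def)
  subgoal by (rule not_in_if_two_reps[of 11 0 0 "31 + 4 * b" 8 19 3 "12 + 4 * b"]; simp add: near_columns near_rows far_members del: One_nat_def)
  subgoal by (rule not_in_if_two_reps[of 11 0 0 11 4 7 7 4]; simp add: near_columns near_rows far_members del: One_nat_def)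
  subgoal by (rule not_in_if_two_reps[of 11 0 0 15 8 13 3 2]; simp add: near_columns near_rows far_members del: One_nat_def)
  subgoal by (rule not_in_if_two_reps[of 11 0 0 19 8 19 3 0]; simp add: near_columns near_rows far_members del: One_nat_def)
  subgoal by (rule not_in_if_two_reps[of 11 0 0 23 8 23 3 0]; simp add: near_columns near_rows far_members del: One_nat_def)
  subgoal by (rule not_in_if_two_reps[of 11 0 0 27 9 24 2 3]; simp add: near_columns near_rows far_members del: One_nat_def)
  done

text \<open>
  The families are tailored to points on or above the diagonal outside the strip and the box; such a
  point has height at least 10, and at least 25 if \<open>x < 10\<close>.
\<close>
lemma above_diagonal:
  assumes "x \<le> y" "(x, y) \<in> V"
  shows "(x, y) \<in> core \<union> T"
proof (cases "x \<le> 3 \<or> x < 10 \<and> y < 25")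
  case True
  then show ?thesis using in_iff_strip in_iff_box assms(2) strip_subset box_subset by blast
next
  case False
  then have x: "4 \<le> x" and far_out: "x < 10 \<Longrightarrow> 25 \<le> y" by auto
  then have y: "10 \<le> y" using \<open>x \<le> y\<close> by (cases "x < 10") auto
  show ?thesis
  proof (rule ccontr)
    assume "(x, y) \<notin> core \<union> T"
    then have nc: "(x mod 4, y mod 4) \<notin> {(1, 0), (3, 0), (0, 1), (0, 3), (2, 2)}"
      by (simp add: core_def)
    have "x mod 4 = 0 \<or> x mod 4 = 1 \<or> x mod 4 = 2 \<or> x mod 4 = 3"
      "y mod 4 = 0 \<or> y mod 4 = 1 \<or> y mod 4 = 2 \<or> y mod 4 = 3" by presburger+
    with nc consider (x_0_y_0) "x mod 4 = 0 \<or> x mod 4 = 2" "y mod 4 = 0"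
      | (x_0_y_2) "x mod 4 = 0" "y mod 4 = 2"
      | (x_2_y_1) "x mod 4 = 2" "y mod 4 = 1" | (x_2_y_3) "x mod 4 = 2" "y mod 4 = 3"
      | (x_1_y_2) "x mod 4 = 1" "y mod 4 = 2" | (x_3_y_2) "x mod 4 = 3" "y mod 4 = 2"
      | (x_1_y_1) "x mod 4 = 1" "y mod 4 = 1" | (x_1_y_3) "x mod 4 = 1" "y mod 4 = 3"
      | (x_3_y_1) "x mod 4 = 3" "y mod 4 = 1" | (x_3_y_3) "x mod 4 = 3" "y mod 4 = 3"
      by atomize_elim (elim disjE; simp)
    then have "(x, y) \<notin> V"
    proof cases
      case x_0_y_0
      obtain a where x_eq: "x = 4 + 2 * a"
        using x_0_y_0(1) x by atomize_elim presburger
      obtain b where y_eq: "y = 12 + 4 * b"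
        using x_0_y_0(2) y by atomize_elim presburger
      show ?thesis unfolding x_eq y_eq by (rule absent_even_even(1))
    next
      case x_0_y_2
      consider (big) "12 \<le> x" | "x = 4" | "x = 8"
        using x_0_y_2(1) x by atomize_elim presburger
      then show ?thesis
      proof cases
        case big
        obtain a where x_eq: "x = 12 + 4 * a"
          using x_0_y_2(1) big by atomize_elim presburger
        obtain b where y_eq: "y = 10 + 4 * b"
          using x_0_y_2(2) y by atomize_elim presburger
        show ?thesis unfolding x_eq y_eq by (rule absent_even_even(2))
      next
        case 2
        then have "25 \<le> y" using far_out by simp
        obtain b where y_eq: "y = 10 + 4 * b"
          using x_0_y_2(2) \<open>25 \<le> y\<close> by atomize_elim presburger
        show ?thesis unfolding \<open>x = 4\<close> y_eq by (rule absent_even_even(3))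
      next
        case 3
        then have "25 \<le> y" using far_out by simp
        obtain b where y_eq: "y = 26 + 4 * b"
          using x_0_y_2(2) \<open>25 \<le> y\<close> by atomize_elim presburger
        show ?thesis unfolding \<open>x = 8\<close> y_eq by (rule absent_even_even(4))
      qed
    next
      case x_2_y_1
      consider (big) "14 \<le> x" | "x = 6" | "x = 10"
        using x_2_y_1(1) x by atomize_elim presburger
      then show ?thesis
      proof cases
        case big
        obtain a where x_eq: "x = 14 + 4 * a"
          using x_2_y_1(1) big by atomize_elim presburger
        obtain b where y_eq: "y = 13 + 4 * b"
          using x_2_y_1(2) y by atomize_elim presburger
        show ?thesis unfolding x_eq y_eq by (rule absent_2_mod_4_odd(1))
      next
        case 2
        then have "25 \<le> y" using far_out by simp
        obtain b where y_eq: "y = 13 + 4 * b"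
          using x_2_y_1(2) \<open>25 \<le> y\<close> by atomize_elim presburger
        show ?thesis unfolding \<open>x = 6\<close> y_eq by (rule absent_2_mod_4_odd(2))
      next
        case 3
        consider (big) "25 \<le> y" | "y = 13" | "y = 17" | "y = 21"
          using x_2_y_1(2) y by atomize_elim presburger
        then show ?thesis
        proof cases
          case big
          obtain b where y_eq: "y = 25 + 4 * b"
            using x_2_y_1(2) big by atomize_elim presburger
          show ?thesis unfolding \<open>x = 10\<close> y_eq by (rule absent_2_mod_4_odd(3))
        qed (use \<open>x = 10\<close> absent_2_mod_4_odd(4-6) in simp_all)
      qed
    next
      case x_2_y_3
      obtain a where x_eq: "x = 6 + 4 * a"
        using x_2_y_3(1) x by atomize_elim presburger
      obtain b where y_eq: "y = 11 + 4 * b"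
        using x_2_y_3(2) y by atomize_elim presburger
      show ?thesis unfolding x_eq y_eq by (rule absent_2_mod_4_odd(7))
    next
      case x_1_y_2
      consider (big) "9 \<le> x" | "x = 5"
        using x_1_y_2(1) x by atomize_elim presburger
      then show ?thesis
      proof cases
        case big
        have "11 \<le> y"
        proof (cases "x < 10")
          case False
          then have "11 \<le> x" using x_1_y_2(1) by presburger
          then show ?thesis using \<open>x \<le> y\<close> by simp
        qed (use far_out in simp)
        obtain a where x_eq: "x = 9 + 4 * a"
          using x_1_y_2(1) big by atomize_elim presburger
        obtain b where y_eq: "y = 14 + 4 * b"
          using x_1_y_2(2) \<open>11 \<le> y\<close> by atomize_elim presburger
        show ?thesis unfolding x_eq y_eq by (rule absent_odd_2_mod_4(1))
      next
        case 2
        then have "25 \<le> y" using far_out by simp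
        obtain b where y_eq: "y = 26 + 4 * b"
          using x_1_y_2(2) \<open>25 \<le> y\<close> by atomize_elim presburger
        show ?thesis unfolding \<open>x = 5\<close> y_eq by (rule absent_odd_2_mod_4(2))
      qed
    next
      case x_3_y_2
      obtain a where x_eq: "x = 7 + 4 * a"
        using x_3_y_2(1) x by atomize_elim presburger
      obtain b where y_eq: "y = 10 + 4 * b"
        using x_3_y_2(2) y by atomize_elim presburger
      show ?thesis unfolding x_eq y_eq by (rule absent_odd_2_mod_4(3))
    next
      case x_1_y_1
      obtain a where x_eq: "x = 5 + 4 * a"
        using x_1_y_1(1) x by atomize_elim presburger
      obtain b where y_eq: "y = 13 + 4 * b"
        using x_1_y_1(2) y by atomize_elim presburger
      show ?thesis unfolding x_eq y_eq by (rule absent_odd_odd(1))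
    next
      case x_1_y_3
      consider (big) "13 \<le> x" | "x = 5" | "x = 9"
        using x_1_y_3(1) x by atomize_elim presburger
      then show ?thesis
      proof cases
        case big
        obtain a where x_eq: "x = 13 + 4 * a"
          using x_1_y_3(1) big by atomize_elim presburger
        obtain b where y_eq: "y = 11 + 4 * b"
          using x_1_y_3(2) y by atomize_elim presburger
        show ?thesis unfolding x_eq y_eq by (rule absent_odd_odd(2))
      next
        case 2
        then have "25 \<le> y" using far_out by simp
        obtain b where y_eq: "y = 15 + 4 * b"
          using x_1_y_3(2) \<open>25 \<le> y\<close> by atomize_elim presburger
        show ?thesis unfolding \<open>x = 5\<close> y_eq by (rule absent_odd_odd(3))
      next
        case 3
        then have "25 \<le> y" using far_out by simp
        obtain b where y_eq: "y = 15 + 4 * b"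
          using x_1_y_3(2) \<open>25 \<le> y\<close> by atomize_elim presburger
        show ?thesis unfolding \<open>x = 9\<close> y_eq by (rule absent_odd_odd(4))
      qed
    next
      case x_3_y_1
      obtain a where x_eq: "x = 7 + 4 * a"
        using x_3_y_1(1) x by atomize_elim presburger
      obtain b where y_eq: "y = 13 + 4 * b"
        using x_3_y_1(2) y by atomize_elim presburger
      show ?thesis unfolding x_eq y_eq by (rule absent_odd_odd(5))
    next
      case x_3_y_3
      consider (big) "15 \<le> x" | "x = 7" | "x = 11"
        using x_3_y_3(1) x by atomize_elim presburger
      then show ?thesis
      proof cases
        case big
        then have "15 \<le> y" using \<open>x \<le> y\<close> by simp
        obtain a where x_eq: "x = 15 + 4 * a"
          using x_3_y_3(1) big by atomize_elim presburger
        obtain b where y_eq: "y = 15 + 4 * b"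
          using x_3_y_3(2) \<open>15 \<le> y\<close> by atomize_elim presburger
        show ?thesis unfolding x_eq y_eq by (rule absent_odd_odd(6))
      next
        case 2
        then have "25 \<le> y" using far_out by simp
        obtain b where y_eq: "y = 11 + 4 * b"
          using x_3_y_3(2) \<open>25 \<le> y\<close> by atomize_elim presburger
        show ?thesis unfolding \<open>x = 7\<close> y_eq by (rule absent_odd_odd(7))
      next
        case 3
        consider (big) "31 \<le> y" | "y = 11" | "y = 15" | "y = 19" | "y = 23" | "y = 27"
          using x_3_y_3(2) y by atomize_elim presburger
        then show ?thesis
        proof cases
          case big
          obtain b where y_eq: "y = 31 + 4 * b"
            using x_3_y_3(2) big by atomize_elim presburger
          show ?thesis unfolding \<open>x = 11\<close> y_eq by (rule absent_odd_odd(8))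
        qed (use \<open>x = 11\<close> absent_odd_odd(9-13) in simp_all)
      qed
    qed
    with assms(2) show False by contradiction
  qed
qed

lemma subset_core_T: "V \<subseteq> core \<union> T"
proof -
  have "(x, y) \<in> core \<union> T" if "(x, y) \<in> V" for x y
  proof (cases "x \<le> y")
    case True
    then show ?thesis using above_diagonal that by blast
  next
    case False
    then have "(y, x) \<in> core \<union> T" using above_diagonal[of y x] that swap_in_iff[of y x] by simp
    then show ?thesis by (rule swap_in_core_T)
  qed
  then show ?thesis by auto
qed

end

theorem corollary5p4:
  assumes "is_vset {(0,1), (1,0)} V"
    and "v \<in> V"
    and "v \<notin> T"
    and "v \<notin> {(0,1), (1,0)}"
  shows "\<exists>P. reps V v = {P} \<and> P \<inter> T \<noteq> {}"
proof -
  have V: "vset_on UNIV {(0, 1), (1, 0)} V"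
    using assms(1) by (rule is_vset_imp_vset_on) (simp add: zero_prod_def)
  have "\<exists>!P. P \<in> reps V v" using V assms(2,4) unfolding vset_on_def by blast
  then obtain P where P: "P \<in> reps V v" and u: "\<And>Q. Q \<in> reps V v \<Longrightarrow> Q = P" by blast
  then have single: "reps V v = {P}" by blast
  from P obtain p q where pq: "P = {p, q}" "p \<in> V" "q \<in> V" "p + q = v" by (rule repsE)
  have "p \<in> T \<or> q \<in> T"
  proof (rule ccontr)
    assume "\<not> (p \<in> T \<or> q \<in> T)"
    then have "p \<in> core" "q \<in> core" using subset_core_T[OF V] pq(2,3) by auto
    then have "v \<notin> core" using core_add_core pq(4) by blast
    moreover have "v \<in> core" using subset_core_T[OF V] assms(2,3) by blast
    ultimately show False by contradiction
  qed
  then have "P \<inter> T \<noteq> {}" using pq(1) by blast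
  with single show ?thesis by blast
qed

end
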